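(* Partition-based Lagrangian cuts are not necessarily dominated by Lagrangian cuts of the original problem. Precisely: there exist an instance of the two-stage stochastic integer program $$\min\Big\{c^{\top}x+\sum_{s\in S}p^s d^{\top}y^s:\ T^sx+Wy^s\ge h^s,\ y^s\in\mathbb{R}^{n_2}_+\ \forall s\in S,\ x\in\mathbb{X}\Big\},$$ a partition $\mathcal{N}$ of $S$, a class $\mathcal{P}\in\mathcal{N}$, a pair $(\pi,\pi_0)\in\mathbb{R}^{n_1}\times\mathbb{R}_+$, and a point $(x,(\theta^s)_{s\in S})\in\mathbb{R}^{n_1}\times\mathbb{R}^{S}$ that satisfies every Lagrangian cut $$\rho^{\top}x+\rho_0\theta^s\ge\bar Q_s^*(\rho,\rho_0)\qquad\forall s\in S,\ \forall(\rho,\rho_0)\in\mathbb{R}^{n_1}\times\mathbb{R}_+,$$ but violates the partition-based Lagrangian cut, i.e. $$\pi^{\top}x+\pi_0\theta^{\mathcal{P}}<\bar Q^*_{\mathcal{P}}(\pi,\pi_0),\qquad\theta^{\mathcal{P}}:=\frac{\sum_{s\in\mathcal{P}}p^s\theta^s}{\sum_{s\in\mathcal{P}}p^s}.$$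
   Context: Here $S$ is a finite set of scenarios, $p^s>0$ is the probability of scenario $s$ ($\sum_{s\in S}p^s=1$), $c\in\mathbb{R}^{n_1}$, $d\in\mathbb{R}^{n_2}$, $A\in\mathbb{R}^{m_1\times n_1}$, $b\in\mathbb{R}^{m_1}$, $W\in\mathbb{R}^{m_2\times n_2}$ (independent of the scenario), $T^s\in\mathbb{R}^{m_2\times n_1}$, $h^s\in\mathbb{R}^{m_2}$ for each $s\in S$, and $\mathbb{X}=\{x\in\mathbb{R}_+^{n_1-p_1}\times\mathbb{Z}_+^{p_1}: Ax=b\}$. For $s\in S$, $K^s=\{(x,y): x\in\mathbb{X},\ y\in\mathbb{R}^{n_2}_+,\ T^sx+Wy\ge h^s\}$ and $\bar Q_s^*(\pi,\pi_0)=\min\{\pi^{\top}x+\pi_0d^{\top}y:(x,y)\in K^s\}$. A partition $\mathcal{N}$ of $S$ is a collection of nonempty pairwise disjoint subsets with union $S$. For $\mathcal{P}\in\mathcal{N}$: $\bar T^{\mathcal{P}}=\frac{\sum_{s\in\mathcal{P}}p^sT^s}{\sum_{s\in\mathcal{P}}p^s}$, $\bar h^{\mathcal{P}}=\frac{\sum_{s\in\mathcal{P}}p^sh^s}{\sum_{s\in\mathcal{P}}p^s}$, $K^{\mathcal{P}}=\{(x,y): x\in\mathbb{X},\ y\in\mathbb{R}^{n_2}_+,\ \bar T^{\mathcal{P}}x+Wy\ge\bar h^{\mathcal{P}}\}$, and $\bar Q^*_{\mathcal{P}}(\pi,\pi_0)=\min\{\pi^{\top}x+\pi_0d^{\top}y:(x,y)\in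 K^{\mathcal{P}}\}$. Minima denote optimal values in $[-\infty,+\infty]$. One class of inequalities dominates another (in the weak sense) if every point satisfying all inequalities of the first class satisfies all inequalities of the second. *)

theory Defs
  imports
    "Jordan_Normal_Form.Matrix"
    "HOL-Library.Extended_Real"
    "HOL-Library.Disjoint_Sets"
begin

text \<open>
  Data of a two-stage stochastic integer program with fixed recourse. The dimensions are natural
  numbers stored in the instance, so that one can quantify over instances of all sizes. Scenarios
  are labelled by natural numbers; components indexed by a scenario outside \<open>scenarios\<close> are
  irrelevant.
\<close>

record sip =
  n1 :: nat
  n2 :: nat
  m1 :: nat
  m2 :: nat
  p1 :: nat
  scenarios :: "nat set"
  prob :: "nat \<Rightarrow> real"
  cost1 :: "real vec"
  cost2 :: "real vec"
  matA :: "real mat"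
  rhsb :: "real vec"
  matW :: "real mat"
  matT :: "nat \<Rightarrow> real mat"
  rhsh :: "nat \<Rightarrow> real vec"

definition sip_instance :: "sip \<Rightarrow> bool" where
  "sip_instance I \<longleftrightarrow>
     p1 I \<le> n1 I \<and>
     finite (scenarios I) \<and>
     (\<forall>s\<in>scenarios I. prob I s > 0) \<and>
     (\<Sum>s\<in>scenarios I. prob I s) = 1 \<and>
     cost1 I \<in> carrier_vec (n1 I) \<and>
     cost2 I \<in> carrier_vec (n2 I) \<and>
     matA I \<in> carrier_mat (m1 I) (n1 I) \<and>
     rhsb I \<in> carrier_vec (m1 I) \<and>
     matW I \<in> carrier_mat (m2 I) (n2 I) \<and>
     (\<forall>s\<in>scenarios I. matT I s \<in> carrier_mat (m2 I) (n1 I)) \<and>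
     (\<forall>s\<in>scenarios I. rhsh I s \<in> carrier_vec (m2 I))"

text \<open>The last \<open>p1\<close> coordinates of a first-stage vector are the integer ones.\<close>

definition first_stage :: "sip \<Rightarrow> real vec set" where
  "first_stage I =
     {x \<in> carrier_vec (n1 I).
        0\<^sub>v (n1 I) \<le> x \<and>
        (\<forall>i. n1 I - p1 I \<le> i \<and> i < n1 I \<longrightarrow> x $ i \<in> \<int>) \<and>
        matA I *\<^sub>v x = rhsb I}"

definition second_stage :: "sip \<Rightarrow> real vec set" where
  "second_stage I = {y \<in> carrier_vec (n2 I). 0\<^sub>v (n2 I) \<le> y}"

definition K_set :: "sip \<Rightarrow> real mat \<Rightarrow> real vec \<Rightarrow> (real vec \<times> real vec) set" where
  "K_set I T h =
     {(x, y). x \<in> first_stage I \<and> y \<in> second_stage I \<and> h \<le> T *\<^sub>v x + matW I *\<^sub>v y}"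

text \<open>The optimal value of the two-stage program itself, with value \<open>\<infinity>\<close> if it is infeasible.\<close>

definition sip_value :: "sip \<Rightarrow> ereal" where
  "sip_value I =
     (INF (x, y) \<in> {(x, y). \<forall>s\<in>scenarios I. (x, y s) \<in> K_set I (matT I s) (rhsh I s)}.
        ereal (cost1 I \<bullet> x + (\<Sum>s\<in>scenarios I. prob I s * (cost2 I \<bullet> y s))))"

text \<open>
  Optimal values are infima in the extended reals: \<open>\<infinity>\<close> for an empty feasible set and
  \<open>-\<infinity>\<close> for an unbounded problem.
\<close>

definition Q_val :: "sip \<Rightarrow> (real vec \<times> real vec) set \<Rightarrow> real vec \<Rightarrow> real \<Rightarrow> ereal" where
  "Q_val I K \<pi> \<pi>0 = (INF (x, y) \<in> K. ereal (\<pi> \<bullet> x + \<pi>0 * (cost2 I \<bullet> y)))"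

definition Q_scen :: "sip \<Rightarrow> nat \<Rightarrow> real vec \<Rightarrow> real \<Rightarrow> ereal" where
  "Q_scen I s = Q_val I (K_set I (matT I s) (rhsh I s))"

definition class_mean :: "sip \<Rightarrow> nat set \<Rightarrow> (nat \<Rightarrow> real) \<Rightarrow> real" where
  "class_mean I P f = (\<Sum>s\<in>P. prob I s * f s) / (\<Sum>s\<in>P. prob I s)"

definition T_class :: "sip \<Rightarrow> nat set \<Rightarrow> real mat" where
  "T_class I P = mat (m2 I) (n1 I) (\<lambda>(i, j). class_mean I P (\<lambda>s. matT I s $$ (i, j)))"

definition h_class :: "sip \<Rightarrow> nat set \<Rightarrow> real vec" where
  "h_class I P = vec (m2 I) (\<lambda>i. class_mean I P (\<lambda>s. rhsh I s $ i))"

definition Q_class :: "sip \<Rightarrow> nat set \<Rightarrow> real vec \<Rightarrow> real \<Rightarrow> ereal" where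
  "Q_class I P = Q_val I (K_set I (T_class I P) (h_class I P))"

end

theory Submission
  imports Defs
begin

text \<open>
  Averaging the constraints of two scenarios treats a first-stage vector as one common decision,
  whereas the Lagrangian cuts of a single scenario only see the closed convex hull of that
  scenario's feasible set. The hulls of two mixed-integer sets can share a fractional point although
  no integer point is cheap in both scenarios, and the averaged problem detects this.

  The instance has two equally likely scenarios, two nonnegative integer first-stage variables and
  one second-stage variable of unit cost. Its constraints make the recourse cost equal
  to \<open>\<bar>x\<^sub>1 - x\<^sub>2\<bar>\<close> in scenario 0 and to \<open>\<bar>x\<^sub>1 + x\<^sub>2 - 1\<bar>\<close> in scenario 1. The first cost
  vanishes at \<open>(0, 0)\<close> and \<open>(1, 1)\<close>, the second one at \<open>(1, 0)\<close> and \<open>(0, 1)\<close>. Both pairs have the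
  midpoint \<open>(1/2, 1/2)\<close>, so this point with \<open>\<theta> = 0\<close> satisfies all Lagrangian cuts (lemma
  \<open>Q_val_le_midpoint\<close>). Averaging the constraints eliminates \<open>x\<^sub>2\<close> and leaves the recourse
  cost \<open>\<bar>x\<^sub>1 - 1/2\<bar>\<close>, which is at least \<open>1/2\<close> for every integer \<open>x\<^sub>1\<close> (lemma
  \<open>half_le_Q_class_parity\<close>). Hence the partition-based cut \<open>\<theta>\<^sup>P \<ge> 1/2\<close> is violated.

  Every first-stage decision admits a feasible recourse in each scenario and in the averaged
  problem, so the violated cut has a finite right-hand side and the failure is not an effect of
  infeasibility.
\<close>

text \<open>A minimum of a linear function is at most its value at each feasible pair, hence at most
  its average over two of them. This is how a fractional point inherits all Lagrangian cuts from
  integer ones.\<close>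

lemma Q_val_le_midpoint:
  assumes "(u, y) \<in> K" and "(v, z) \<in> K"
    and dims: "u \<in> carrier_vec n" "v \<in> carrier_vec n" "\<rho> \<in> carrier_vec n"
  shows "Q_val I K \<rho> \<rho>0 \<le>
    ereal (\<rho> \<bullet> ((1/2) \<cdot>\<^sub>v (u + v)) + \<rho>0 * ((cost2 I \<bullet> y + cost2 I \<bullet> z) / 2))"
proof -
  let ?f = "\<lambda>u y. \<rho> \<bullet> u + \<rho>0 * (cost2 I \<bullet> y)"
  have 1: "Q_val I K \<rho> \<rho>0 \<le> ereal (?f u y)" and 2: "Q_val I K \<rho> \<rho>0 \<le> ereal (?f v z)"
    unfolding Q_val_def using assms(1,2) by (auto intro: INF_lower2)
  have "Q_val I K \<rho> \<rho>0 \<le> ereal (min (?f u y) (?f v z))"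
    using 1 2 by (simp add: min_def)
  also have "\<dots> \<le> ereal ((?f u y + ?f v z) / 2)"
    by (simp add: min_def del: ereal_min)
  also have "(?f u y + ?f v z) / 2 =
      \<rho> \<bullet> ((1/2) \<cdot>\<^sub>v (u + v)) + \<rho>0 * ((cost2 I \<bullet> y + cost2 I \<bullet> z) / 2)"
    using dims by (simp add: scalar_prod_add_distrib field_simps)
  finally show ?thesis .
qed

text \<open>The absolute value of an affine function is the least \<open>y\<close> above the function and its
  negative; each scenario has one row for either sign. The rows are ordered so that \<open>x\<^sub>2\<close> has
  opposite signs in corresponding rows of the two scenarios.\<close>

definition parity_T :: "nat \<Rightarrow> real mat" where
  "parity_T s = mat_of_rows_list 2 (if s = 0 then [[-1, 1], [1, -1]] else [[-1, -1], [1, 1]])"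

definition parity_h :: "nat \<Rightarrow> real vec" where
  "parity_h s = vec_of_list (if s = 0 then [0, 0] else [-1, 1])"

text \<open>The recourse cost measures how far an integer point is from having equal entries
  (scenario 0) or entry sum 1 (scenario 1). The matrix \<open>matA\<close> has no rows, so
  integrality and nonnegativity are the only first-stage constraints.\<close>

definition parity_sip :: sip where
  "parity_sip = \<lparr>n1 = 2, n2 = 1, m1 = 0, m2 = 2, p1 = 2, scenarios = {0, 1}, prob = (\<lambda>_. 1/2),
     cost1 = 0\<^sub>v 2, cost2 = vec_of_list [1], matA = 0\<^sub>m 0 2, rhsb = 0\<^sub>v 0,
     matW = mat_of_rows_list 1 [[1], [1]], matT = parity_T, rhsh = parity_h\<rparr>"

lemma parity_T_carrier: "parity_T s \<in> carrier_mat 2 2"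
  by (rule carrier_matI) (simp_all add: parity_T_def mat_of_rows_list_def)

lemma parity_h_carrier: "parity_h s \<in> carrier_vec 2"
  by (rule carrier_vecI) (simp add: parity_h_def)

lemma sip_instance_parity: "sip_instance parity_sip"
proof -
  have "cost2 parity_sip \<in> carrier_vec 1"
    by (rule carrier_vecI) (simp add: parity_sip_def)
  moreover have "matW parity_sip \<in> carrier_mat 2 1"
    by (rule carrier_matI) (simp_all add: parity_sip_def mat_of_rows_list_def)
  ultimately show ?thesis
    using parity_T_carrier parity_h_carrier by (simp add: sip_instance_def parity_sip_def)
qed

lemma K_set_parity_iff:
  assumes "T \<in> carrier_mat 2 2" and "h \<in> carrier_vec 2"
  shows "(x, y) \<in> K_set parity_sip T h \<longleftrightarrow>
    x \<in> carrier_vec 2 \<and> y \<in> carrier_vec 1 \<and>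
    0 \<le> x $ 0 \<and> 0 \<le> x $ 1 \<and> x $ 0 \<in> \<int> \<and> x $ 1 \<in> \<int> \<and> 0 \<le> y $ 0 \<and>
    h $ 0 \<le> T $$ (0, 0) * x $ 0 + T $$ (0, 1) * x $ 1 + y $ 0 \<and>
    h $ 1 \<le> T $$ (1, 0) * x $ 0 + T $$ (1, 1) * x $ 1 + y $ 0"
proof -
  have range_2: "{0..<2} = {0, 1::nat}"
    by auto
  have "x \<in> first_stage parity_sip \<longleftrightarrow>
      x \<in> carrier_vec 2 \<and> 0 \<le> x $ 0 \<and> 0 \<le> x $ 1 \<and> x $ 0 \<in> \<int> \<and> x $ 1 \<in> \<int>"
    by (auto simp: first_stage_def parity_sip_def less_eq_vec_def less_2_cases_iff)
  moreover have "y \<in> second_stage parity_sip \<longleftrightarrow> y \<in> carrier_vec 1 \<and> 0 \<le> y $ 0"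
    by (auto simp: second_stage_def parity_sip_def less_eq_vec_def)
  moreover have "h \<le> T *\<^sub>v x + matW parity_sip *\<^sub>v y \<longleftrightarrow>
      h $ 0 \<le> T $$ (0, 0) * x $ 0 + T $$ (0, 1) * x $ 1 + y $ 0 \<and>
      h $ 1 \<le> T $$ (1, 0) * x $ 0 + T $$ (1, 1) * x $ 1 + y $ 0"
    if "x \<in> carrier_vec 2" "y \<in> carrier_vec 1"
    using assms that
    by (auto simp: parity_sip_def less_eq_vec_def All_less_Suc mat_of_rows_list_def
        scalar_prod_def range_2)
  ultimately show ?thesis
    by (auto simp: K_set_def)
qed

text \<open>In each scenario the point \<open>(1/2, 1/2)\<close> is the midpoint of two integer points without
  recourse cost, so \<open>\<theta> = 0\<close> lies above every Lagrangian bound there.\<close>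

lemma parity_lagrangian_cuts:
  assumes \<rho>: "\<rho> \<in> carrier_vec 2"
  shows "Q_scen parity_sip s \<rho> \<rho>0 \<le> ereal (\<rho> \<bullet> vec_of_list [1/2, 1/2])"
proof -
  define u :: "real vec" where "u = vec_of_list (if s = 0 then [0, 0] else [1, 0])"
  define v :: "real vec" where "v = vec_of_list (if s = 0 then [1, 1] else [0, 1])"
  have carrier: "u \<in> carrier_vec 2" "v \<in> carrier_vec 2"
    by (simp_all add: u_def v_def carrier_dim_vec)
  have feasible: "(u, 0\<^sub>v 1) \<in> K_set parity_sip (parity_T s) (parity_h s)"
      "(v, 0\<^sub>v 1) \<in> K_set parity_sip (parity_T s) (parity_h s)"
    using carrier unfolding K_set_parity_iff[OF parity_T_carrier parity_h_carrier]
    by (auto simp: u_def v_def parity_T_def parity_h_def mat_of_rows_list_def)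
  have midpoint: "(1/2) \<cdot>\<^sub>v (u + v) = vec_of_list [1/2, 1/2]"
    by (rule eq_vecI) (auto simp: u_def v_def less_Suc_eq)
  show ?thesis
    using Q_val_le_midpoint[OF feasible carrier \<rho>, of parity_sip \<rho>0] midpoint
    by (simp add: Q_scen_def parity_sip_def)
qed

text \<open>In the averaged constraints \<open>x\<^sub>2\<close> cancels, and what is left is \<open>y \<ge> \<bar>x\<^sub>1 - 1/2\<bar>\<close>. Every
  integer \<open>x\<^sub>1\<close> is at distance at least \<open>1/2\<close> from \<open>1/2\<close>.\<close>

lemma half_le_Q_class_parity:
  "ereal (1/2) \<le> Q_class parity_sip {0, 1} (0\<^sub>v 2) 1"
proof -
  let ?T = "T_class parity_sip {0, 1}" and ?h = "h_class parity_sip {0, 1}"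
  have T: "?T \<in> carrier_mat 2 2" and h: "?h \<in> carrier_vec 2"
    by (auto simp: T_class_def h_class_def parity_sip_def)
  have entries: "?T $$ (0, 0) = -1" "?T $$ (0, 1) = 0" "?T $$ (1, 0) = 1" "?T $$ (1, 1) = 0"
      "?h $ 0 = -1/2" "?h $ 1 = 1/2"
    by (simp_all add: T_class_def h_class_def class_mean_def parity_sip_def parity_T_def
        parity_h_def mat_of_rows_list_def)
  have "1/2 \<le> y $ 0" if K: "(x, y) \<in> K_set parity_sip ?T ?h" for x y
  proof -
    have "x $ 0 \<in> \<int>" and "x $ 0 - 1/2 \<le> y $ 0" and "1/2 - x $ 0 \<le> y $ 0"
      using K unfolding K_set_parity_iff[OF T h] entries by auto
    moreover obtain k :: int where k: "x $ 0 = of_int k"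
      using \<open>x $ 0 \<in> \<int>\<close> by (auto elim: Ints_cases)
    moreover have "k \<le> 0 \<or> 1 \<le> k"
      by linarith
    ultimately show ?thesis
      by auto
  qed
  moreover have "0\<^sub>v 2 \<bullet> x + 1 * (cost2 parity_sip \<bullet> y) = y $ 0"
    if "(x, y) \<in> K_set parity_sip ?T ?h" for x y
    using that unfolding K_set_parity_iff[OF T h] by (auto simp: parity_sip_def scalar_prod_def)
  ultimately show ?thesis
    unfolding Q_class_def Q_val_def by (auto intro!: INF_greatest)
qed

theorem theorem1:
  shows "\<exists>(I :: sip) (N :: nat set set) (P :: nat set) (\<pi> :: real vec) (\<pi>0 :: real)
           (x :: real vec) (\<theta> :: nat \<Rightarrow> real).
     sip_instance I \<and>
     partition_on (scenarios I) N \<and>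
     P \<in> N \<and>
     \<pi> \<in> carrier_vec (n1 I) \<and> \<pi>0 \<ge> 0 \<and>
     x \<in> carrier_vec (n1 I) \<and>
     (\<forall>s\<in>scenarios I. \<forall>\<rho>\<in>carrier_vec (n1 I). \<forall>\<rho>0\<ge>0.
        ereal (\<rho> \<bullet> x + \<rho>0 * \<theta> s) \<ge> Q_scen I s \<rho> \<rho>0) \<and>
     ereal (\<pi> \<bullet> x + \<pi>0 * class_mean I P \<theta>) < Q_class I P \<pi> \<pi>0"
proof -
  let ?x = "vec_of_list [1/2, 1/2] :: real vec"
  have dims: "n1 parity_sip = 2" "scenarios parity_sip = {0, 1}"
    by (simp_all add: parity_sip_def)
  have x: "?x \<in> carrier_vec 2"
    by (simp add: carrier_dim_vec)
  have partition: "partition_on (scenarios parity_sip) {{0, 1}}"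
    by (auto simp: dims intro!: partition_onI)
  have cuts: "\<forall>s\<in>scenarios parity_sip. \<forall>\<rho>\<in>carrier_vec (n1 parity_sip). \<forall>\<rho>0\<ge>0.
      Q_scen parity_sip s \<rho> \<rho>0 \<le> ereal (\<rho> \<bullet> ?x + \<rho>0 * 0)"
    using parity_lagrangian_cuts dims by simp
  have "0\<^sub>v 2 \<bullet> ?x + 1 * class_mean parity_sip {0, 1} (\<lambda>_. 0) = 0"
    using x by (simp add: class_mean_def)
  then have violated: "ereal (0\<^sub>v 2 \<bullet> ?x + 1 * class_mean parity_sip {0, 1} (\<lambda>_. 0))
      < Q_class parity_sip {0, 1} (0\<^sub>v 2) 1"
    by (intro less_le_trans[OF _ half_le_Q_class_parity]) simp
  show ?thesis
    by (rule exI[of _ parity_sip], rule exI[of _ "{{0, 1}}"], rule exI[of _ "{0, 1}"],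
        rule exI[of _ "0\<^sub>v 2"], rule exI[of _ 1], rule exI[of _ ?x], rule exI[of _ "\<lambda>_. 0"])
       (intro conjI sip_instance_parity partition cuts violated;
        simp add: dims x del: vec_of_list_Cons)
qed

end
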